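(* Let $Q=(q_0,q_1)\in(1,\infty)^2$ satisfy $q_0+q_1\ge q_0q_1$, let $I_Q=\left[0,\frac{1}{q_1-1}\right]$, $r_Q=\frac{q_0}{q_1}$ and $\ell_Q=\frac{q_1}{q_0(q_1-1)}-1$. Let $h_{g,Q}$ and $h_{l,Q}$ be the densities (with respect to the Lebesgue measure) of the unique absolutely continuous invariant probability measures on $I_Q$ of the greedy map $G$ and of the lazy map $L$, respectively. Define for $x\in I_Q$ $$\tilde h_{g,Q}(x)=\sum_{n=0}^{\infty}\frac{1}{q_1^{s(n)}q_0^{n-s(n)}}\,1_{[0,G^n(r_Q))}(x),\qquad \tilde h_{l,Q}(x)=\sum_{n=0}^{\infty}\frac{1}{q_0^{n-t(n)}q_1^{t(n)}}\,1_{\left(L^n(\ell_Q),\frac{1}{q_1-1}\right]}(x),$$ where $s(n)$ is the sum of the first $n$ digits of the greedy expansion of $r_Q$ and $t(n)$ is the sum of the first $n$ digits of the lazy expansion of $\ell_Q$. Then $h_{g,Q}$ is proportional to $\tilde h_{g,Q}$ and $h_{l,Q}$ is proportional to $\tilde h_{l,Q}$ (i.e. each equals a constant multiple of the other, as functions defined Lebesgue almost everywhere on $I_Q$).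
   Context: For $Q=(q_0,q_1)\in(1,\infty)^2$ with $q_0+q_1\ge q_0q_1$, put $I_Q=\left[0,\frac{1}{q_1-1}\right]$; then $r_Q,\ell_Q\in I_Q$. The greedy map $G:I_Q\to I_Q$ is defined by $G(x)=q_0x$ if $x\in I_0:=\left[0,\frac1{q_1}\right)$ and $G(x)=q_1x-1$ if $x\in I_1:=\left[\frac1{q_1},\frac1{q_1-1}\right]$. The greedy expansion $(b_i)_{i\ge1}\in\{0,1\}^\infty$ of $x\in I_Q$ is given by $b_n=j\iff G^{n-1}(x)\in I_j$ ($j=0,1$). The lazy map $L:I_Q\to I_Q$ is defined by $L(x)=q_0x$ if $x\in J_0:=\left[0,\frac{1}{q_0(q_1-1)}\right]$ and $L(x)=q_1x-1$ if $x\in J_1:=\left(\frac{1}{q_0(q_1-1)},\frac{1}{q_1-1}\right]$. The lazy expansion $(l_i)_{i\ge1}\in\{0,1\}^\infty$ of $x\in I_Q$ is given by $l_n=j\iff L^{n-1}(x)\in J_j$ ($j=0,1$). $G^n,L^n$ denote $n$-fold iterates ($G^0,L^0$ the identity), $s(0)=t(0)=0$, and $1_A$ is the indicator function of $A$. Each of $G$ and $L$ has a unique invariant probability measure on $I_Q$ that is absolutely continuous with respect to the Lebesgue measure. *)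

theory Defs
  imports "HOL-Probability.Probability"
begin

definition I_Q :: "real \<Rightarrow> real \<Rightarrow> real set" where
  "I_Q q0 q1 = {0 .. 1 / (q1 - 1)}"

definition r_Q :: "real \<Rightarrow> real \<Rightarrow> real" where
  "r_Q q0 q1 = q0 / q1"

definition l_Q :: "real \<Rightarrow> real \<Rightarrow> real" where
  "l_Q q0 q1 = q1 / (q0 * (q1 - 1)) - 1"

text \<open>The greedy and lazy maps are total functions on the reals; only their restrictions to
  \<open>I_Q q0 q1\<close>, which they map into itself when \<open>q0, q1 > 1\<close> and \<open>q0 * q1 \<le> q0 + q1\<close>, are meaningful.
  On that interval, membership in \<open>greedy_I1\<close> (\<open>lazy_J1\<close>) is the negation of membership in
  \<open>greedy_I0\<close> (\<open>lazy_J0\<close>).  Digits are indexed from 1.\<close>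

definition greedy_I0 :: "real \<Rightarrow> real \<Rightarrow> real set" where
  "greedy_I0 q0 q1 = {0 ..< 1 / q1}"

definition greedy_I1 :: "real \<Rightarrow> real \<Rightarrow> real set" where
  "greedy_I1 q0 q1 = {1 / q1 .. 1 / (q1 - 1)}"

definition greedy_map :: "real \<Rightarrow> real \<Rightarrow> real \<Rightarrow> real" where
  "greedy_map q0 q1 x = (if x \<in> greedy_I0 q0 q1 then q0 * x else q1 * x - 1)"

definition greedy_digit :: "real \<Rightarrow> real \<Rightarrow> real \<Rightarrow> nat \<Rightarrow> nat" where
  "greedy_digit q0 q1 x n =
     (if (greedy_map q0 q1 ^^ (n - 1)) x \<in> greedy_I1 q0 q1 then 1 else 0)"

definition lazy_J0 :: "real \<Rightarrow> real \<Rightarrow> real set" where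
  "lazy_J0 q0 q1 = {0 .. 1 / (q0 * (q1 - 1))}"

definition lazy_J1 :: "real \<Rightarrow> real \<Rightarrow> real set" where
  "lazy_J1 q0 q1 = {1 / (q0 * (q1 - 1)) <.. 1 / (q1 - 1)}"

definition lazy_map :: "real \<Rightarrow> real \<Rightarrow> real \<Rightarrow> real" where
  "lazy_map q0 q1 x = (if x \<in> lazy_J0 q0 q1 then q0 * x else q1 * x - 1)"

definition lazy_digit :: "real \<Rightarrow> real \<Rightarrow> real \<Rightarrow> nat \<Rightarrow> nat" where
  "lazy_digit q0 q1 x n =
     (if (lazy_map q0 q1 ^^ (n - 1)) x \<in> lazy_J1 q0 q1 then 1 else 0)"

definition s_Q :: "real \<Rightarrow> real \<Rightarrow> nat \<Rightarrow> nat" where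
  "s_Q q0 q1 n = (\<Sum>i = 1..n. greedy_digit q0 q1 (r_Q q0 q1) i)"

definition t_Q :: "real \<Rightarrow> real \<Rightarrow> nat \<Rightarrow> nat" where
  "t_Q q0 q1 n = (\<Sum>i = 1..n. lazy_digit q0 q1 (l_Q q0 q1) i)"

text \<open>For \<open>q0, q1 > 1\<close> both series are dominated by a geometric series in \<open>1 / min q0 q1\<close>.\<close>

definition h_tilde_g :: "real \<Rightarrow> real \<Rightarrow> real \<Rightarrow> real" where
  "h_tilde_g q0 q1 x =
     (\<Sum>n. 1 / (q1 ^ s_Q q0 q1 n * q0 ^ (n - s_Q q0 q1 n)) *
           indicator {0 ..< (greedy_map q0 q1 ^^ n) (r_Q q0 q1)} x)"

definition h_tilde_l :: "real \<Rightarrow> real \<Rightarrow> real \<Rightarrow> real" where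
  "h_tilde_l q0 q1 x =
     (\<Sum>n. 1 / (q0 ^ (n - t_Q q0 q1 n) * q1 ^ t_Q q0 q1 n) *
           indicator {(lazy_map q0 q1 ^^ n) (l_Q q0 q1) <.. 1 / (q1 - 1)} x)"

definition acip :: "real set \<Rightarrow> (real \<Rightarrow> real) \<Rightarrow> real measure \<Rightarrow> bool" where
  "acip I T \<mu> \<longleftrightarrow>
     sets \<mu> = sets (restrict_space borel I) \<and>
     prob_space \<mu> \<and>
     absolutely_continuous (restrict_space lborel I) \<mu> \<and>
     T \<in> measurable \<mu> \<mu> \<and> distr \<mu> \<mu> T = \<mu>"

text \<open>Nonnegativity is required explicitly because \<open>ennreal\<close> sends negative reals to 0.\<close>

definition is_density_on :: "real set \<Rightarrow> real measure \<Rightarrow> (real \<Rightarrow> real) \<Rightarrow> bool" where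
  "is_density_on I \<mu> h \<longleftrightarrow>
     h \<in> borel_measurable (restrict_space lborel I) \<and>
     (AE x in restrict_space lborel I. 0 \<le> h x) \<and>
     \<mu> = density (restrict_space lborel I) (\<lambda>x. ennreal (h x))"

definition proportional_ae :: "real set \<Rightarrow> (real \<Rightarrow> real) \<Rightarrow> (real \<Rightarrow> real) \<Rightarrow> bool" where
  "proportional_ae I f g \<longleftrightarrow>
     (\<exists>c. AE x in restrict_space lborel I. f x = c * g x) \<and>
     (\<exists>c. AE x in restrict_space lborel I. g x = c * f x)"

end

theory Submission imports Defs begin

text \<open>
  Call an integrable \<open>F\<close> stationary for \<open>T\<close> if the signed measure \<open>F dx\<close> is invariant under \<open>T\<close>.
  The theorem follows from two facts about the greedy map \<open>G\<close>: its stationary densities, supported on its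
  interval and taken up to null sets, form a space of dimension at most one, and the series \<open>h_tilde_g\<close> is a nonzero member of it.

  Uniqueness (\<open>stationary_unique\<close>).  If \<open>F\<close> is stationary, then the points of \<open>{F > 0}\<close> stay in
  \<open>{F > 0}\<close> almost surely, and likewise for \<open>{F < 0}\<close>.  Now \<open>G\<close> is increasing and affine on two
  branches whose images both start at \<open>0\<close>.  Hence an interval, iterated under \<open>G\<close>, is stretched until
  it contains the discontinuity \<open>1 / q1\<close>, and the part to the right of \<open>1 / q1\<close> is then
  mapped to an initial interval \<open>[0, c)\<close>, which in turn grows until it covers \<open>[0, 1 / q1)\<close>.  If
  a forward invariant set \<open>A\<close> misses a positive proportion of \<open>[0, 1 / q1)\<close>, then pulling back shows
  that it misses a fixed proportion of every interval, so \<open>A\<close> is null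
  (\<open>forward_invariant_dichotomy\<close>).  The disjoint sets \<open>{F > 0}\<close> and \<open>{F < 0}\<close> cannot
  both contain almost all of \<open>[0, 1 / q1)\<close>, so one of them is null.  A stationary \<open>F\<close> with integral
  \<open>0\<close> therefore vanishes almost everywhere.

  Existence (\<open>stationary_h_tilde_g\<close>).  The map \<open>G\<close> transports Lebesgue measure on \<open>[0, x)\<close> to a multiple
  of Lebesgue measure on \<open>[0, G x)\<close>, plus, if \<open>x\<close> has digit \<open>1\<close>, the measure on \<open>[0, r_Q)\<close>
  divided by \<open>q0\<close>.  Along the orbit of \<open>r_Q\<close> the first contributions shift the series by one term;
  the second ones restore the missing first term because the digits expand \<open>r_Q\<close> itself.  Both
  effects are combined in one telescoping sum.

  The lazy map for \<open>(q0, q1)\<close> is conjugate to the greedy map for \<open>(q1, q0)\<close> by a decreasing affine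
  map of one interval onto the other, which takes one series to the other.
\<close>

section \<open>Stationary densities\<close>

text \<open>Signed functions are admitted, so that differences of invariant densities fall under the definition.\<close>

definition stationary :: "(real \<Rightarrow> real) \<Rightarrow> (real \<Rightarrow> real) \<Rightarrow> bool" where
  "stationary T F \<longleftrightarrow> integrable lborel F \<and>
     (\<forall>A\<in>sets borel. (\<integral>x. indicator (T -` A) x * F x \<partial>lborel) = (\<integral>x. indicator A x * F x \<partial>lborel))"

lemma stationary_diff_scaled:
  assumes "stationary T F" "stationary T H" and T[measurable]: "T \<in> borel_measurable borel"
  shows "stationary T (\<lambda>x. F x - c * H x)"
proof -
  have iF: "integrable lborel F" and iH: "integrable lborel H"
    using assms by (auto simp: stationary_def)
  have split: "(\<integral>x. indicator A x * (F x - c * H x) \<partial>lborel) =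
      (\<integral>x. indicator A x * F x \<partial>lborel) - c * (\<integral>x. indicator A x * H x \<partial>lborel)"
    if A: "A \<in> sets borel" for A
  proof -
    have "integrable lborel (\<lambda>x. indicator A x * F x)" "integrable lborel (\<lambda>x. indicator A x * H x)"
      using integrable_mult_indicator[OF _ iF, of A] integrable_mult_indicator[OF _ iH, of A] A by auto
    then show ?thesis by (simp add: algebra_simps)
  qed
  have "T -` A \<in> sets borel" if "A \<in> sets borel" for A
    using measurable_sets[OF T that] by simp
  then show ?thesis
    using assms iF iH by (simp add: stationary_def split)
qed

text \<open>
  With \<open>A = {F > 0}\<close>, no set carries more mass of \<open>F\<close> than \<open>A\<close>, and a set carrying equal mass
  contains almost all of \<open>A\<close>.  Stationarity says that the preimage of \<open>A\<close> is such a set.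
\<close>

lemma stationary_positive_set_forward_invariant:
  assumes st: "stationary T F" and T[measurable]: "T \<in> borel_measurable borel"
  shows "AE x in lborel. F x > 0 \<longrightarrow> F (T x) > 0"
proof -
  have iF: "integrable lborel F" using st by (simp add: stationary_def)
  then have [measurable]: "F \<in> borel_measurable borel" by auto
  define A where "A = {x. F x > 0}"
  have A[measurable]: "A \<in> sets borel" unfolding A_def by measurable
  have TA[measurable]: "T -` A \<in> sets borel" using measurable_sets[OF T A] by simp
  have i1: "integrable lborel (\<lambda>x. indicator A x * F x)"
    using integrable_mult_indicator[OF _ iF, of A] by simp
  have i2: "integrable lborel (\<lambda>x. indicator (T -` A) x * F x)"
    using integrable_mult_indicator[OF _ iF, of "T -` A"] by simp
  \<comment> \<open>Nonnegative everywhere, with integral zero by stationarity.\<close>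
  define g where "g x = indicator A x * F x - indicator (T -` A) x * F x" for x
  have ig: "integrable lborel g" unfolding g_def using i1 i2 by simp
  have "integral\<^sup>L lborel g = 0"
    unfolding g_def using st i1 i2 A by (simp add: stationary_def)
  moreover have "g x \<ge> 0" for x by (auto simp: g_def A_def indicator_def)
  ultimately have "AE x in lborel. g x = 0"
    using integral_nonneg_eq_0_iff_AE[OF ig] by simp
  then show ?thesis
    by eventually_elim (auto simp: g_def A_def indicator_def split: if_splits)
qed

section \<open>Sets that miss a fixed proportion of every interval\<close>

text \<open>
  A weak substitute for the Lebesgue density theorem.  Cover \<open>A\<close> by nonoverlapping intervals
  with total length at most \<open>measure A + e\<close>.  The part of the cover outside \<open>A\<close> has
  measure at most \<open>e\<close>, but also at least \<open>\<delta>\<close> times the length of the cover.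
\<close>

lemma null_if_uniformly_missed_on_intervals:
  fixes c \<delta> :: real
  assumes A[measurable]: "A \<in> sets borel" and Asub: "A \<subseteq> {0..c}" and c: "c > 0" and \<delta>: "\<delta> > 0"
    and miss: "\<And>a b. 0 \<le> a \<Longrightarrow> a \<le> b \<Longrightarrow> b \<le> c \<Longrightarrow> \<delta> * (b - a) \<le> measure lborel ({a<..<b} - A)"
  shows "measure lborel A = 0"
proof (rule ccontr)
  assume "measure lborel A \<noteq> 0"
  then have pos: "measure lborel A > 0" by (simp add: zero_less_measure_iff)
  define e where "e = \<delta> * measure lborel A / 2"
  have e: "e > 0" using pos \<delta> by (simp add: e_def)
  have AL: "A \<in> lmeasurable"
    by (rule bounded_set_imp_lmeasurable) (use Asub bounded_subset[OF bounded_closed_interval] A in auto)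
  obtain D where D: "countable D"
      "\<And>K. K \<in> D \<Longrightarrow> K \<subseteq> cbox 0 c \<and> K \<noteq> {} \<and> (\<exists>u v. K = cbox u v)"
      "pairwise (\<lambda>A B. interior A \<inter> interior B = {}) D"
      "\<And>K. K \<in> D \<Longrightarrow> interior K \<noteq> {}"
      "A \<subseteq> \<Union>D" "\<Union>D \<in> lmeasurable" "measure lebesgue (\<Union>D) \<le> measure lebesgue A + e"
    using measurable_outer_intervals_bounded[OF AL, of 0 c e] Asub e c
    by (metis box_real(1) cbox_interval greaterThanLessThan_empty_iff not_le)
  have KB: "K \<in> sets borel" if "K \<in> D" for K using D(2)[OF that] by auto
  have DB[measurable]: "\<Union>D \<in> sets borel" using D(1) KB by blast
  \<comment> \<open>Members of the cover may share endpoints; the interiors are disjoint and lose only a null set.\<close>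
  define U where "U = (\<Union>K\<in>D. interior K)"
  have UB[measurable]: "U \<in> sets borel" unfolding U_def by (intro borel_open open_UN) auto
  have UD: "U \<subseteq> \<Union>D" unfolding U_def using interior_subset by blast
  have Dc: "\<Union>D \<subseteq> {0..c}" using D(2) by auto
  have fin: "emeasure lborel X < \<infinity>" if "X \<subseteq> {0..c}" for X
    using emeasure_bounded_finite[of X] that bounded_subset[OF bounded_closed_interval] by auto
  have dis: "disjoint_family_on interior D"
    using D(3) by (auto simp: disjoint_family_on_def pairwise_def)
  have "\<Union>D - U \<in> null_sets lborel"
  proof (rule null_sets_subset)
    show "(\<Union>K\<in>D. K - interior K) \<in> null_sets lborel"
    proof (rule null_sets_UN'[OF D(1)])
      fix K assume "K \<in> D"
      then obtain u v where K: "K = {u..v}" using D(2)[of K] by auto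
      have "K - interior K \<subseteq> {u,v}" unfolding K by (auto simp: interior_atLeastAtMost_real)
      then have "finite (K - interior K)" by (rule finite_subset) auto
      then show "K - interior K \<in> null_sets lborel" by (rule finite_imp_null_set_lborel)
    qed
    show "\<Union>D - U \<in> sets lborel" by simp
  qed (auto simp: U_def)
  then have eq: "emeasure lborel U = emeasure lborel (\<Union>D)"
    using emeasure_Diff_null_set[of "\<Union>D - U" lborel "\<Union>D"] UD
    by (simp add: double_diff)
  have piece: "ennreal \<delta> * emeasure lborel (interior K) \<le> emeasure lborel (interior K - A)" if "K \<in> D" for K
  proof -
    have "\<exists>u v. K = {u..v}" using D(2)[OF that] by auto
    then obtain u v where K: "K = {u..v}" by blast
    have "{u..v} \<subseteq> {0..c}" "u \<le> v" using D(2)[OF that] K by auto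
    then have uv: "0 \<le> u" "u \<le> v" "v \<le> c" by auto
    have iK: "interior K = {u<..<v}" by (simp add: K interior_atLeastAtMost_real)
    have "emeasure lborel ({u<..<v} - A) = ennreal (measure lborel ({u<..<v} - A))"
      using fin[of "{u<..<v} - A"] uv by (intro emeasure_eq_ennreal_measure) fastforce
    then show ?thesis using miss[OF uv] uv \<delta>
      by (simp add: iK ennreal_mult[symmetric])
  qed
  have "ennreal \<delta> * emeasure lborel U = ennreal \<delta> * (\<integral>\<^sup>+K. emeasure lborel (interior K) \<partial>count_space D)"
    unfolding U_def by (subst emeasure_UN_countable) (use D(1) dis in auto)
  also have "\<dots> = (\<integral>\<^sup>+K. ennreal \<delta> * emeasure lborel (interior K) \<partial>count_space D)"
    by (simp add: nn_integral_cmult)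
  also have "\<dots> \<le> (\<integral>\<^sup>+K. emeasure lborel (interior K - A) \<partial>count_space D)"
    by (rule nn_integral_mono) (use piece in auto)
  also have "\<dots> = emeasure lborel (\<Union>K\<in>D. interior K - A)"
    by (subst emeasure_UN_countable) (use D(1) dis in \<open>auto simp: disjoint_family_on_def\<close>)
  also have "\<dots> \<le> emeasure lborel (\<Union>D - A)"
    by (rule emeasure_mono) (use interior_subset in auto)
  finally have le: "ennreal \<delta> * emeasure lborel (\<Union>D) \<le> emeasure lborel (\<Union>D - A)"
    by (simp add: eq)
  have fD: "emeasure lborel (\<Union>D) < \<infinity>" "emeasure lborel (\<Union>D - A) < \<infinity>"
    using fin[of "\<Union>D"] fin[of "\<Union>D - A"] Dc by blast+
  have le2: "\<delta> * measure lborel (\<Union>D) \<le> measure lborel (\<Union>D - A)"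
    using le fD \<delta> by (simp add: emeasure_eq_ennreal_measure ennreal_mult[symmetric])
  have "measure lborel (\<Union>D - A) = measure lborel (\<Union>D) - measure lborel A"
    using fD D(5) by (intro measure_Diff) auto
  moreover have "measure lborel A \<le> measure lborel (\<Union>D)"
    using fD D(5) by (intro measure_mono_fmeasurable) (auto simp: fmeasurable_def)
  moreover have "measure lborel (\<Union>D) \<le> measure lborel A + e"
    using D(7) DB A by (simp add: measure_completion)
  ultimately have "\<delta> * measure lborel A \<le> e"
    using le2 \<delta> by (smt (verit) mult_left_mono)
  then show False using e by (simp add: e_def)
qed

lemma measure_affine_preimage:
  fixes q e a b :: real
  assumes q: "q > 0" and S[measurable]: "S \<in> sets borel"
  shows "measure lborel ({q*a-e..<q*b-e} \<inter> S) = q * measure lborel ({a..<b} \<inter> {x. q * x - e \<in> S})"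
proof -
  have "measure lborel ({q*a-e..<q*b-e} \<inter> S) = (\<integral>x. indicator ({q*a-e..<q*b-e} \<inter> S) x \<partial>lborel)"
    by simp
  also have "\<dots> = \<bar>q\<bar> *\<^sub>R (\<integral>x. indicator ({q*a-e..<q*b-e} \<inter> S) (- e + q * x) \<partial>lborel)"
    using q by (intro lborel_integral_real_affine) auto
  also have "(\<lambda>x. indicator ({q*a-e..<q*b-e} \<inter> S) (- e + q * x)) =
     (indicator ({a..<b} \<inter> {x. q * x - e \<in> S}) :: real \<Rightarrow> real)"
    using q by (auto simp: indicator_def fun_eq_iff)
  finally show ?thesis using q by simp
qed

lemma measure_bounded_mono_AE:
  fixes S S' :: "real set"
  assumes "AE x in lborel. x \<in> S \<longrightarrow> x \<in> S'" "S' \<in> sets borel" "bounded S'" 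
  shows "measure lborel S \<le> measure lborel S'"
proof -
  have "emeasure lborel S \<le> emeasure lborel S'"
    using assms by (intro emeasure_mono_AE) auto
  then show ?thesis
    unfolding measure_def
    by (intro enn2real_mono) (use emeasure_bounded_finite[OF assms(3)] in auto)
qed

section \<open>Ergodicity of the greedy map\<close>

locale two_bases =
  fixes q0 q1 :: real
  assumes q0: "q0 > 1" and q1: "q1 > 1" and q01: "q0 + q1 \<ge> q0 * q1"
begin

abbreviation G where "G \<equiv> greedy_map q0 q1"
abbreviation N where "N \<equiv> 1 / (q1 - 1)"

lemma N_pos: "N > 0" using q1 by simp

lemma greedy_left: "0 \<le> x \<Longrightarrow> x < 1 / q1 \<Longrightarrow> G x = q0 * x"
  by (simp add: greedy_map_def greedy_I0_def)

lemma greedy_right: "1 / q1 \<le> x \<Longrightarrow> G x = q1 * x - 1"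
  by (simp add: greedy_map_def greedy_I0_def)

lemma inverse_q1_less_N: "1 / q1 < N" using q1 by (simp add: divide_simps)

lemma r_Q_pos: "0 < r_Q q0 q1" using q0 q1 by (simp add: r_Q_def)

lemma r_Q_le_N: "r_Q q0 q1 \<le> N"
  using q0 q1 q01 by (simp add: r_Q_def divide_simps algebra_simps)

text \<open>The endpoint \<open>N\<close> is the fixed point of the right branch.\<close>

lemma le_N_iff: "x \<le> N \<longleftrightarrow> q1 * x - 1 \<le> x"
  using q1 by (simp add: field_simps)

lemma greedy_in_I:
  assumes "x \<in> {0..N}" shows "G x \<in> {0..N}"
proof (cases "x < 1 / q1")
  case True
  have "q0 * x \<le> q0 * (1 / q1)" using True q0 by (intro mult_left_mono) auto
  also have "\<dots> \<le> N" using r_Q_le_N by (simp add: r_Q_def)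
  finally show ?thesis using True assms q0 by (simp add: greedy_left)
next
  case False
  then have "q1 * x \<ge> 1" using q1 by (simp add: field_simps)
  then show ?thesis using False assms le_N_iff[of x] by (simp add: greedy_right)
qed

lemma greedy_measurable [measurable]: "G \<in> borel_measurable borel"
  unfolding greedy_map_def[abs_def] greedy_I0_def by measurable

text \<open>
  Let \<open>m a b\<close> be the length of the part of \<open>[a, b)\<close> outside \<open>A\<close>.  Forward invariance means that
  a branch with slope \<open>q\<close> multiplies \<open>m\<close> by at most \<open>q\<close>, while it multiplies lengths by exactly \<open>q\<close>;
  a lower bound for the missed proportion of an image is thus inherited by the interval itself.  Initial
  intervals \<open>[0, c)\<close> inherit such a bound from those of length at least \<open>1 / q1\<close>.  For a general
  interval the only piece not yet controlled is the one left of \<open>1 / q1\<close> in a cut; since it is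
  stretched at each step by at least \<open>min q0 q1\<close>, what it still lacks after \<open>n\<close> steps shrinks geometrically.
\<close>

lemma forward_invariant_dichotomy:
  assumes A[measurable]: "A \<in> sets borel" and AI: "A \<subseteq> {0..N}"
    and inv: "AE x in lborel. x \<in> A \<longrightarrow> G x \<in> A"
  shows "measure lborel A = 0 \<or> measure lborel ({0..<1 / q1} - A) = 0"
proof (rule disjCI)
  assume "measure lborel ({0..<1 / q1} - A) \<noteq> 0"
  then have miss: "measure lborel ({0..<1 / q1} - A) > 0" by (simp add: zero_less_measure_iff)
  define m where "m a b = measure lborel ({a..<b} - A)" for a b
  \<comment> \<open>Every initial interval of length at least \<open>1 / q1\<close> is missed in at least this proportion.\<close>
  define \<delta> where "\<delta> = m 0 (1 / q1) / N"
  have \<delta>: "\<delta> > 0" using miss N_pos q1 by (simp add: \<delta>_def m_def)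
  have m_nonneg: "m a b \<ge> 0" for a b by (simp add: m_def)
  have m_split: "m a b = m a c + m c b" if "a \<le> c" "c \<le> b" for a b c
  proof -
    have "{a..<b} - A = ({a..<c} - A) \<union> ({c..<b} - A)" using that by auto
    moreover have "emeasure lborel ({x..<y} - A) < \<infinity>" for x y
      by (intro emeasure_bounded_finite bounded_subset[OF bounded_closed_interval[of x y]]) auto
    ultimately show ?thesis unfolding m_def
      by (subst measure_Un_AE[symmetric]) (auto simp: less_top intro!: AE_I2 fmeasurableI)
  qed
  have push_left: "m (q0 * a) (q0 * b) \<le> q0 * m a b" if ab: "0 \<le> a" "b \<le> 1 / q1" for a b
  proof -
    have "m (q0 * a) (q0 * b) = q0 * measure lborel ({a..<b} \<inter> {x. q0 * x - 0 \<in> - A})"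
      using measure_affine_preimage[of q0 "- A" a 0 b] q0 by (simp add: m_def Diff_eq)
    also have "measure lborel ({a..<b} \<inter> {x. q0 * x - 0 \<in> - A}) \<le> m a b"
      unfolding m_def
    proof (rule measure_bounded_mono_AE)
      show "AE x in lborel. x \<in> {a..<b} \<inter> {x. q0 * x - 0 \<in> - A} \<longrightarrow> x \<in> {a..<b} - A"
        using inv by eventually_elim (use ab greedy_left in fastforce)
    qed (auto intro: bounded_subset[OF bounded_closed_interval[of a b]])
    finally show ?thesis using q0 by simp
  qed
  have push_right: "m (q1 * a - 1) (q1 * b - 1) \<le> q1 * m a b" if ab: "1 / q1 \<le> a" for a b
  proof -
    have "m (q1 * a - 1) (q1 * b - 1) = q1 * measure lborel ({a..<b} \<inter> {x. q1 * x - 1 \<in> - A})"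
      using measure_affine_preimage[of q1 "- A" a 1 b] q1 by (simp add: m_def Diff_eq)
    also have "measure lborel ({a..<b} \<inter> {x. q1 * x - 1 \<in> - A}) \<le> m a b"
      unfolding m_def
    proof (rule measure_bounded_mono_AE)
      show "AE x in lborel. x \<in> {a..<b} \<inter> {x. q1 * x - 1 \<in> - A} \<longrightarrow> x \<in> {a..<b} - A"
        using inv by eventually_elim (use ab greedy_right in fastforce)
    qed (auto intro: bounded_subset[OF bounded_closed_interval[of a b]])
    finally show ?thesis using q1 by simp
  qed
  \<comment> \<open>Induction on the number of left branches that make \<open>[0, c)\<close> at least \<open>1 / q1\<close> long.\<close>
  have initial: "\<delta> * c \<le> m 0 c" if "0 \<le> c" "c \<le> N" "1 / q1 \<le> q0 ^ k * c" for k c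
    using that
  proof (induction k arbitrary: c)
    case 0
    have "\<delta> * c \<le> \<delta> * N" using 0 \<delta> by (intro mult_left_mono) auto
    also have "\<dots> = m 0 (1 / q1)" using N_pos q1 by (simp add: \<delta>_def)
    also have "\<dots> \<le> m 0 c" using m_split[of 0 "1 / q1" c] m_nonneg[of "1 / q1" c] 0 q1 by simp
    finally show ?case .
  next
    case (Suc k)
    show ?case
    proof (cases "c < 1 / q1")
      case True
      then have "q0 * c \<le> N"
        using greedy_in_I[of c] greedy_left[of c] Suc.prems by simp
      then have "\<delta> * (q0 * c) \<le> m 0 (q0 * c)"
        using Suc.prems q0 by (intro Suc.IH) (auto simp: mult_ac)
      also have "\<dots> \<le> q0 * m 0 c" using push_left[of 0 c] True by simp
      finally show ?thesis using q0 by (simp add: mult.left_commute)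
    next
      case False
      have "\<delta> * c \<le> \<delta> * N" using Suc \<delta> by (intro mult_left_mono) auto
      also have "\<dots> = m 0 (1 / q1)" using N_pos q1 by (simp add: \<delta>_def)
      also have "\<dots> \<le> m 0 c" using m_split[of 0 "1 / q1" c] m_nonneg[of "1 / q1" c] False q1 by simp
      finally show ?thesis .
    qed
  qed
  have initial: "\<delta> * c \<le> m 0 c" if c: "0 \<le> c" "c \<le> N" for c
  proof (cases "c = 0")
    case True
    then show ?thesis using m_nonneg by simp
  next
    case False
    obtain k where "1 / (q1 * c) < q0 ^ k" using real_arch_pow[OF q0] by blast
    then show ?thesis using c False q1 by (intro initial[of c k]) (auto simp: field_simps)
  qed
  define q where "q = min q0 q1"
  have q: "q > 1" "q \<le> q0" "q \<le> q1" using q0 q1 by (auto simp: q_def)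
  have general: "\<delta> * (b - a - N / q ^ n) \<le> m a b" if "0 \<le> a" "a \<le> b" "b \<le> N" for n a b
    using that
  proof (induction n arbitrary: a b)
    case 0
    have "\<delta> * (b - a - N) \<le> 0" using 0 \<delta> by (intro mult_nonneg_nonpos) auto
    then show ?case using m_nonneg[of a b] by simp
  next
    case (Suc n)
    have step: "\<delta> * (b - a - N / q ^ Suc n) \<le> m a b"
      if "\<delta> * (p * (b - a) - N / q ^ n) \<le> p * m a b" "p \<ge> q" for p a b
    proof -
      have "p * (\<delta> * (b - a - N / q ^ Suc n)) \<le> \<delta> * (p * (b - a) - N / q ^ n)"
      proof -
        have "N / q ^ n \<le> p * (N / q ^ Suc n)"
          using q N_pos that(2) by (simp add: divide_simps)
        then have "\<delta> * (N / q ^ n) \<le> \<delta> * (p * (N / q ^ Suc n))" using \<delta> by (intro mult_left_mono) auto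
        then show ?thesis by (simp add: algebra_simps)
      qed
      also note that(1)
      finally show ?thesis using q that(2) by simp
    qed
    have left: "\<delta> * (b - a - N / q ^ Suc n) \<le> m a b" if "0 \<le> a" "a \<le> b" "b \<le> 1 / q1" for a b
    proof (rule step[of q0])
      have "q0 * b \<le> q0 * (1 / q1)" using that q0 by (intro mult_left_mono) auto
      then have "q0 * b \<le> N" using r_Q_le_N by (simp add: r_Q_def)
      then have "\<delta> * (q0 * b - q0 * a - N / q ^ n) \<le> m (q0 * a) (q0 * b)"
        using that q0 by (intro Suc.IH) (auto intro: mult_left_mono)
      also have "\<dots> \<le> q0 * m a b" using push_left that by simp
      finally show "\<delta> * (q0 * (b - a) - N / q ^ n) \<le> q0 * m a b" by (simp add: algebra_simps)
    qed (use q in auto)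
    consider "b \<le> 1 / q1" | "1 / q1 \<le> a" | "a < 1 / q1" "1 / q1 < b" by linarith
    then show ?case
    proof cases
      case 1
      then show ?thesis using left Suc.prems by simp
    next
      case 2
      show ?thesis
      proof (rule step[of q1])
        have "1 \<le> q1 * a" using 2 q1 by (simp add: field_simps)
        moreover have "q1 * b - 1 \<le> N" using Suc.prems le_N_iff[of b] by linarith
        moreover have "q1 * a \<le> q1 * b" using Suc.prems q1 by simp
        ultimately have "\<delta> * ((q1 * b - 1) - (q1 * a - 1) - N / q ^ n) \<le> m (q1 * a - 1) (q1 * b - 1)"
          by (intro Suc.IH) auto
        also have "\<dots> \<le> q1 * m a b" using push_right 2 by simp
        finally show "\<delta> * (q1 * (b - a) - N / q ^ n) \<le> q1 * m a b" by (simp add: algebra_simps)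
      qed (use q in auto)
    next
      case 3
      \<comment> \<open>The right piece maps to an initial interval and costs no error; the left one is as before.\<close>
      have "1 \<le> q1 * b" using 3 q1 by (simp add: field_simps)
      moreover have "q1 * b - 1 \<le> N" using Suc.prems le_N_iff[of b] by linarith
      ultimately have "\<delta> * (q1 * b - 1) \<le> m 0 (q1 * b - 1)" by (intro initial) auto
      also have "\<dots> \<le> q1 * m (1 / q1) b" using push_right[of "1 / q1" b] q1 by simp
      also have "\<delta> * (q1 * b - 1) = q1 * (\<delta> * (b - 1 / q1))" using q1 by (simp add: field_simps)
      finally have "\<delta> * (b - 1 / q1) \<le> m (1 / q1) b" using q1 by simp
      moreover have "\<delta> * (1 / q1 - a - N / q ^ Suc n) \<le> m a (1 / q1)"
        using left 3 Suc.prems by simp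
      ultimately show ?thesis using m_split[of a "1 / q1" b] 3 by (simp add: algebra_simps)
    qed
  qed
  have lower: "\<delta> * (b - a) \<le> m a b" if ab: "0 \<le> a" "a \<le> b" "b \<le> N" for a b
  proof (rule LIMSEQ_le_const2)
    have "(\<lambda>n. N * (1 / q) ^ n) \<longlonglongrightarrow> N * 0"
      using q by (intro tendsto_mult_left LIMSEQ_power_zero) auto
    then have "(\<lambda>n. \<delta> * (b - a - N * (1 / q) ^ n)) \<longlonglongrightarrow> \<delta> * (b - a - 0)"
      by (intro tendsto_intros) simp
    then show "(\<lambda>n. \<delta> * (b - a - N / q ^ n)) \<longlonglongrightarrow> \<delta> * (b - a)"
      by (simp add: power_divide)
  qed (use general ab in auto)
  show "measure lborel A = 0"
  proof (rule null_if_uniformly_missed_on_intervals[OF A AI N_pos \<delta>])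
    fix a b :: real assume ab: "0 \<le> a" "a \<le> b" "b \<le> N"
    have "m a b \<le> measure lborel ({a<..<b} - A)"
      unfolding m_def
    proof (rule measure_bounded_mono_AE)
      show "AE x in lborel. x \<in> {a..<b} - A \<longrightarrow> x \<in> {a<..<b} - A"
        using AE_lborel_singleton[of a] by eventually_elim auto
    qed (auto intro: bounded_subset[OF bounded_closed_interval[of a b]])
    with lower[OF ab] show "\<delta> * (b - a) \<le> measure lborel ({a<..<b} - A)" by simp
  qed
qed

text \<open>
  The sets \<open>{F > 0}\<close> and \<open>{F < 0}\<close> are disjoint and forward invariant, so by the dichotomy one of them
  is null; then \<open>F\<close> has a constant sign and integral zero.
\<close>

lemma stationary_integral_zero:
  assumes st: "stationary G F" and supp: "\<And>x. x \<notin> {0..N} \<Longrightarrow> F x = 0"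
    and int0: "integral\<^sup>L lborel F = 0"
  shows "AE x in lborel. F x = 0"
proof -
  have iF: "integrable lborel F" using st by (simp add: stationary_def)
  then have [measurable]: "F \<in> borel_measurable borel" by auto
  have stm: "stationary G (\<lambda>x. - F x)" using st by (simp add: stationary_def)
  define P where "P = {x. F x > 0}"
  define M where "M = {x. - F x > 0}"
  have [measurable]: "P \<in> sets borel" "M \<in> sets borel" unfolding P_def M_def by measurable
  have PI: "P \<subseteq> {0..N}" and MI: "M \<subseteq> {0..N}"
    using supp by (fastforce simp only: P_def M_def mem_Collect_eq neg_0_less_iff_less less_irrefl)+
  have bd: "emeasure lborel S \<noteq> \<infinity>" if "S \<subseteq> {0..N}" for S
    using emeasure_bounded_finite[OF bounded_subset[OF bounded_closed_interval that]] by simp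
  have "AE x in lborel. x \<in> P \<longrightarrow> G x \<in> P"
    using stationary_positive_set_forward_invariant[OF st greedy_measurable] by (simp add: P_def)
  then have P: "measure lborel P = 0 \<or> measure lborel ({0..<1 / q1} - P) = 0"
    by (intro forward_invariant_dichotomy PI) simp
  have "AE x in lborel. x \<in> M \<longrightarrow> G x \<in> M"
    using stationary_positive_set_forward_invariant[OF stm greedy_measurable] by (simp add: M_def)
  then have M: "measure lborel M = 0 \<or> measure lborel ({0..<1 / q1} - M) = 0"
    by (intro forward_invariant_dichotomy MI) simp
  have null: "AE x in lborel. x \<notin> S" if "measure lborel S = 0" "S \<in> sets borel" "S \<subseteq> {0..N}" for S
  proof -
    have "emeasure lborel S = 0"
      using that(1) bd[OF that(3)] by (simp add: emeasure_eq_ennreal_measure)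
    then show ?thesis using that(2) by (intro AE_not_in null_setsI) simp_all
  qed
  have sub: "{0..<1 / q1} - S \<subseteq> {0..N}" for S using inverse_q1_less_N by auto
  have "\<not> (measure lborel ({0..<1 / q1} - P) = 0 \<and> measure lborel ({0..<1 / q1} - M) = 0)"
  proof
    assume "measure lborel ({0..<1 / q1} - P) = 0 \<and> measure lborel ({0..<1 / q1} - M) = 0"
    then have "AE x in lborel. x \<notin> {0..<1 / q1} - P" "AE x in lborel. x \<notin> {0..<1 / q1} - M"
      using null[of "{0..<1 / q1} - P"] null[of "{0..<1 / q1} - M"] sub by simp_all
    then have "AE x in lborel. x \<notin> {0..<1 / q1}"
      by eventually_elim (auto simp: P_def M_def)
    then have "{0..<1 / q1} \<in> null_sets lborel" using AE_iff_null_sets[of "{0..<1 / q1}" lborel] by simp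
    then have "emeasure lborel {0..<1 / q1} = 0" by (rule null_setsD1)
    then show False using q1 by simp
  qed
  with P M consider "measure lborel P = 0" | "measure lborel M = 0" by blast
  then show ?thesis
  proof cases
    case 1
    then have "AE x in lborel. x \<notin> P" using PI by (intro null) auto
    then have "AE x in lborel. 0 \<le> - F x" by eventually_elim (simp add: P_def)
    then show ?thesis
      using integral_nonneg_eq_0_iff_AE[of lborel "\<lambda>x. - F x"] iF int0 by simp
  next
    case 2
    then have "AE x in lborel. x \<notin> M" using MI by (intro null) auto
    then have "AE x in lborel. 0 \<le> F x" by eventually_elim (simp add: M_def)
    then show ?thesis
      using integral_nonneg_eq_0_iff_AE[of lborel "\<lambda>x. F x"] iF int0 by simp
  qed
qed

lemma stationary_unique:
  assumes F: "stationary G F" "\<And>x. x \<notin> {0..N} \<Longrightarrow> F x = 0" "integral\<^sup>L lborel F = 1"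
    and H: "stationary G H" "\<And>x. x \<notin> {0..N} \<Longrightarrow> H x = 0"
  shows "AE x in lborel. H x = integral\<^sup>L lborel H * F x"
proof -
  have "AE x in lborel. H x - integral\<^sup>L lborel H * F x = 0"
  proof (rule stationary_integral_zero)
    show "stationary G (\<lambda>x. H x - integral\<^sup>L lborel H * F x)"
      by (intro stationary_diff_scaled H F greedy_measurable)
    show "(\<integral>x. H x - integral\<^sup>L lborel H * F x \<partial>lborel) = 0"
      using F H by (simp add: stationary_def)
  qed (use F H in auto)
  then show ?thesis by simp
qed

section \<open>The greedy series is stationary\<close>

abbreviation orbit where "orbit n \<equiv> (G ^^ n) (r_Q q0 q1)"

text \<open>
  The reciprocal of the product of the slopes of the branches met by the first \<open>n\<close> points of the
  orbit of \<open>r_Q\<close>; see \<open>weight_Suc\<close>.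
\<close>

definition weight :: "nat \<Rightarrow> real" where
  "weight n = 1 / (q1 ^ s_Q q0 q1 n * q0 ^ (n - s_Q q0 q1 n))"

lemma h_tilde_g_weight: "h_tilde_g q0 q1 x = (\<Sum>n. weight n * indicator {0..<orbit n} x)"
  by (simp add: h_tilde_g_def weight_def)

lemma orbit_in_I: "orbit n \<in> {0..N}"
proof (induction n)
  case 0
  then show ?case using r_Q_pos r_Q_le_N by simp
next
  case (Suc n)
  then show ?case using greedy_in_I by simp
qed

lemma s_Q_le: "s_Q q0 q1 n \<le> n"
proof -
  have "s_Q q0 q1 n \<le> (\<Sum>i = 1..n. 1)"
    unfolding s_Q_def by (intro sum_mono) (simp add: greedy_digit_def)
  then show ?thesis by simp
qed

lemma weight_0 [simp]: "weight 0 = 1" by (simp add: weight_def s_Q_def)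

lemma weight_pos: "weight n > 0" using q0 q1 by (simp add: weight_def)

lemma weight_Suc: "weight (Suc n) = weight n / (if orbit n < 1 / q1 then q0 else q1)"
proof -
  have "s_Q q0 q1 (Suc n) = s_Q q0 q1 n + (if orbit n < 1 / q1 then 0 else 1)"
    using orbit_in_I[of n] by (simp add: s_Q_def greedy_digit_def greedy_I1_def)
  then show ?thesis
    using s_Q_le[of n] by (simp add: weight_def Suc_diff_le)
qed

lemma weight_le: "weight n \<le> (1 / min q0 q1) ^ n"
proof (induction n)
  case (Suc n)
  have "weight (Suc n) \<le> weight n / min q0 q1"
    using weight_pos[of n] q0 q1 by (simp add: weight_Suc frac_le)
  also have "\<dots> \<le> (1 / min q0 q1) ^ n / min q0 q1"
    using Suc q0 q1 by (intro divide_right_mono) auto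
  finally show ?case by (simp add: mult.commute)
qed simp

lemma summable_weight: "summable weight"
proof (rule summable_comparison_test')
  show "summable (\<lambda>n. (1 / min q0 q1) ^ n)"
    using q0 q1 by (intro summable_geometric) auto
  show "norm (weight n) \<le> (1 / min q0 q1) ^ n" for n
    using weight_le[of n] weight_pos[of n] by simp
qed

lemma integral_h_tilde_g_sums:
  assumes A[measurable]: "A \<in> sets borel"
  shows "integrable lborel (\<lambda>x. indicator A x * h_tilde_g q0 q1 x)"
    and "(\<lambda>n. weight n * measure lborel ({0..<orbit n} \<inter> A)) sums
           (\<integral>x. indicator A x * h_tilde_g q0 q1 x \<partial>lborel)"
proof -
  define f :: "nat \<Rightarrow> real \<Rightarrow> real" where "f n x = weight n * indicator ({0..<orbit n} \<inter> A) x" for n x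
  have fin: "emeasure lborel ({0..<orbit n} \<inter> A) < \<infinity>" for n
    by (intro emeasure_bounded_finite bounded_subset[OF bounded_closed_interval[of 0 "orbit n"]]) auto
  have int: "integrable lborel (f n)" for n
    unfolding f_def using fin[of n] by (intro integrable_mult_right integrable_real_indicator) auto
  have norm_f: "\<bar>f n x\<bar> = f n x" for n x using weight_pos[of n] by (simp add: f_def)
  have val: "(\<integral>x. f n x \<partial>lborel) = weight n * measure lborel ({0..<orbit n} \<inter> A)" for n
    by (simp add: f_def)
  have sum_f: "summable (\<lambda>n. f n x)" for x
    by (rule summable_comparison_test'[OF summable_weight, of 0])
       (use weight_pos in \<open>auto simp: f_def indicator_def abs_of_pos less_imp_le\<close>)
  have sum_int: "summable (\<lambda>n. \<integral>x. norm (f n x) \<partial>lborel)"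
  proof (rule summable_comparison_test'[OF summable_mult[OF summable_weight, of N], of 0])
    fix n :: nat
    have "measure lborel ({0..<orbit n} \<inter> A) \<le> measure lborel {0..<orbit n}"
      by (intro measure_bounded_mono_AE) (auto intro: bounded_subset[OF bounded_closed_interval[of 0 "orbit n"]])
    also have "\<dots> \<le> N" using orbit_in_I[of n] by simp
    finally have "measure lborel ({0..<orbit n} \<inter> A) \<le> N" .
    then have "weight n * measure lborel ({0..<orbit n} \<inter> A) \<le> weight n * N"
      using weight_pos[of n] by (intro mult_left_mono) auto
    then show "norm (\<integral>x. norm (f n x) \<partial>lborel) \<le> N * weight n"
      using weight_pos[of n] by (simp add: norm_f val abs_mult)
  qed
  have sum_norm: "AE x in lborel. summable (\<lambda>n. norm (f n x))"
    using sum_f by (simp add: norm_f)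
  have eq: "(\<Sum>n. f n x) = indicator A x * h_tilde_g q0 q1 x" for x
    by (cases "x \<in> A") (simp_all add: h_tilde_g_weight f_def indicator_inter_arith)
  show "integrable lborel (\<lambda>x. indicator A x * h_tilde_g q0 q1 x)"
    using integrable_suminf[OF int sum_norm sum_int] by (simp add: eq)
  show "(\<lambda>n. weight n * measure lborel ({0..<orbit n} \<inter> A)) sums
           (\<integral>x. indicator A x * h_tilde_g q0 q1 x \<partial>lborel)"
    using sums_integral[OF int sum_norm sum_int] by (simp add: eq val)
qed

text \<open>
  The image of Lebesgue measure on \<open>[0, x)\<close> under \<open>G\<close>: the branch containing \<open>x\<close> yields \<open>[0, G x)\<close>,
  and if this is the right branch, the whole left branch contributes \<open>[0, r_Q)\<close>.
\<close>

lemma measure_greedy_preimage: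
  assumes x: "x \<in> {0..N}" and A[measurable]: "A \<in> sets borel"
  shows "measure lborel ({0..<x} \<inter> G -` A) =
    (if x < 1 / q1 then measure lborel ({0..<G x} \<inter> A) / q0
     else measure lborel ({0..<G x} \<inter> A) / q1 + measure lborel ({0..<r_Q q0 q1} \<inter> A) / q0)"
proof -
  have left: "measure lborel ({0..<y} \<inter> G -` A) = measure lborel ({0..<q0 * y} \<inter> A) / q0"
    if "y \<le> 1 / q1" for y
  proof -
    have "{0..<y} \<inter> G -` A = {0..<y} \<inter> {z. q0 * z - 0 \<in> A}"
      using that greedy_left by auto
    then show ?thesis using measure_affine_preimage[OF _ A, of q0 0 0 y] q0 by simp
  qed
  show ?thesis
  proof (cases "x < 1 / q1")
    case True
    then show ?thesis using left[of x] greedy_left[of x] x by simp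
  next
    case False
    have right: "{1 / q1..<x} \<inter> G -` A = {1 / q1..<x} \<inter> {z. q1 * z - 1 \<in> A}"
      using greedy_right by auto
    have GA[measurable]: "G -` A \<in> sets borel"
      using measurable_sets[OF greedy_measurable A] by simp
    have nonneg: "0 \<le> y" if "1 / q1 \<le> y" for y
      by (rule order_trans[OF _ that]) (use q1 in simp)
    have "{0..<x} \<inter> G -` A = ({0..<1 / q1} \<inter> G -` A) \<union> ({1 / q1..<x} \<inter> G -` A)"
      using False by (auto dest: nonneg)
    moreover have "emeasure lborel ({u..<v} \<inter> G -` A) < \<infinity>" for u v
      by (intro emeasure_bounded_finite bounded_subset[OF bounded_closed_interval[of u v]]) auto
    ultimately have "measure lborel ({0..<x} \<inter> G -` A) =
        measure lborel ({0..<1 / q1} \<inter> G -` A) + measure lborel ({1 / q1..<x} \<inter> G -` A)"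
      by (simp only:, intro measure_Un_AE) (auto simp: less_top intro!: AE_I2 fmeasurableI)
    then show ?thesis
      using left[of "1 / q1"] measure_affine_preimage[OF _ A, of q1 "1 / q1" 1 x] q1 False
        greedy_right[of x] right by (simp add: r_Q_def)
  qed
qed

text \<open>
  Stationarity on \<open>A\<close> compares two series with general terms \<open>weight n * measure ([0, orbit n) \<inter> G -` A)\<close>
  and \<open>weight n * measure ([0, orbit n) \<inter> A)\<close>.  Their difference telescopes: each digit \<open>1\<close>
  contributes \<open>weight n / q0\<close> times the measure of \<open>[0, r_Q) \<inter> A\<close>, and \<open>weight n / q1\<close> is exactly
  the decrease of \<open>weight n * orbit n\<close>, the remainder in the expansion of \<open>r_Q\<close>.
\<close>

lemma stationary_h_tilde_g: "stationary G (h_tilde_g q0 q1)"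
  unfolding stationary_def
proof (intro conjI ballI)
  show "integrable lborel (h_tilde_g q0 q1)"
    using integral_h_tilde_g_sums(1)[of UNIV] by simp
next
  fix A :: "real set" assume A[measurable]: "A \<in> sets borel"
  have GA: "G -` A \<in> sets borel"
    using measurable_sets[OF greedy_measurable A] by simp
  define a where "a x = measure lborel ({0..<x} \<inter> A)" for x
  \<comment> \<open>The first term is what the digits from \<open>n + 1\<close> on still contribute; at \<open>n = 0\<close> the terms cancel.\<close>
  define u where "u n = a (r_Q q0 q1) / r_Q q0 q1 * (weight n * orbit n) - weight n * a (orbit n)" for n
  have a_bounds: "0 \<le> a x" "a x \<le> N" if "x \<in> {0..N}" for x
  proof -
    have "a x \<le> measure lborel {0..<x}" unfolding a_def
      by (intro measure_bounded_mono_AE) (auto intro: bounded_subset[OF bounded_closed_interval[of 0 x]])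
    then show "0 \<le> a x" "a x \<le> N" using that by (auto simp: a_def)
  qed
  have "weight n * measure lborel ({0..<orbit n} \<inter> G -` A) - weight n * a (orbit n) = u n - u (Suc n)" for n
  proof (cases "orbit n < 1 / q1")
    case True
    then show ?thesis
      using measure_greedy_preimage[OF orbit_in_I A, of n] greedy_left[of "orbit n"] orbit_in_I[of n] q0
      by (simp add: u_def a_def weight_Suc)
  next
    case False
    have "weight (Suc n) * orbit (Suc n) = weight n / q1 * (q1 * orbit n - 1)"
      using False by (simp add: weight_Suc greedy_right)
    also have "\<dots> = weight n * orbit n - weight n / q1"
      using q1 by (simp add: field_simps)
    finally have "weight n * orbit n - weight (Suc n) * orbit (Suc n) = weight n / q1" by simp
    moreover have "u n - u (Suc n) =
        a (r_Q q0 q1) / r_Q q0 q1 * (weight n * orbit n - weight (Suc n) * orbit (Suc n))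
        - weight n * a (orbit n) + weight (Suc n) * a (orbit (Suc n))"
      unfolding u_def right_diff_distrib by linarith
    ultimately have "u n - u (Suc n) = a (r_Q q0 q1) / r_Q q0 q1 * (weight n / q1)
        - weight n * a (orbit n) + weight (Suc n) * a (orbit (Suc n))"
      by (simp only:)
    moreover have "a (r_Q q0 q1) / r_Q q0 q1 * (weight n / q1) = weight n * (a (r_Q q0 q1) / q0)"
      using q0 q1 by (simp add: r_Q_def)
    moreover have "weight n * measure lborel ({0..<orbit n} \<inter> G -` A) =
        weight (Suc n) * a (orbit (Suc n)) + weight n * (a (r_Q q0 q1) / q0)"
      using measure_greedy_preimage[OF orbit_in_I A, of n] False
      by (simp add: a_def weight_Suc distrib_left)
    ultimately show ?thesis by linarith
  qed
  moreover have "(\<lambda>n. u n - u (Suc n)) sums (u 0 - 0)"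
  proof (rule telescope_sums')
    have w0: "weight \<longlonglongrightarrow> 0" by (rule summable_LIMSEQ_zero[OF summable_weight])
    have "(\<lambda>n. weight n * y n) \<longlonglongrightarrow> 0" if "\<And>n. 0 \<le> y n \<and> y n \<le> N" for y
    proof (rule tendsto_sandwich[OF _ _ tendsto_const])
      show "(\<lambda>n. weight n * N) \<longlonglongrightarrow> 0" using tendsto_mult_right[OF w0, of N] by simp
      show "\<forall>\<^sub>F n in sequentially. 0 \<le> weight n * y n"
        using that weight_pos by (simp add: less_imp_le)
      show "\<forall>\<^sub>F n in sequentially. weight n * y n \<le> weight n * N"
        using that weight_pos by (intro always_eventually allI mult_left_mono) (auto intro: less_imp_le)
    qed
    from this[of orbit] this[of "\<lambda>n. a (orbit n)"]
    have "(\<lambda>n. weight n * orbit n) \<longlonglongrightarrow> 0" "(\<lambda>n. weight n * a (orbit n)) \<longlonglongrightarrow> 0"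
      using orbit_in_I a_bounds by auto
    then have "u \<longlonglongrightarrow> a (r_Q q0 q1) / r_Q q0 q1 * 0 - 0"
      unfolding u_def by (intro tendsto_intros)
    then show "u \<longlonglongrightarrow> 0" by simp
  qed
  moreover have "u 0 = 0" using r_Q_pos by (simp add: u_def)
  ultimately have "(\<lambda>n. weight n * measure lborel ({0..<orbit n} \<inter> G -` A) - weight n * a (orbit n)) sums 0"
    by simp
  moreover have "(\<lambda>n. weight n * measure lborel ({0..<orbit n} \<inter> G -` A) - weight n * a (orbit n)) sums
      ((\<integral>x. indicator (G -` A) x * h_tilde_g q0 q1 x \<partial>lborel) - (\<integral>x. indicator A x * h_tilde_g q0 q1 x \<partial>lborel))"
    unfolding a_def by (intro sums_diff integral_h_tilde_g_sums GA A)
  ultimately show "(\<integral>x. indicator (G -` A) x * h_tilde_g q0 q1 x \<partial>lborel) =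
      (\<integral>x. indicator A x * h_tilde_g q0 q1 x \<partial>lborel)"
    using sums_unique2 by fastforce
qed

lemma h_tilde_g_outside: "x \<notin> {0..N} \<Longrightarrow> h_tilde_g q0 q1 x = 0"
proof -
  assume x: "x \<notin> {0..N}"
  have "x \<notin> {0..<orbit n}" for n using orbit_in_I[of n] x by auto
  then show ?thesis by (simp add: h_tilde_g_weight)
qed

lemma integral_h_tilde_g_pos: "integral\<^sup>L lborel (h_tilde_g q0 q1) > 0"
proof -
  have s: "(\<lambda>n. weight n * measure lborel {0..<orbit n}) sums integral\<^sup>L lborel (h_tilde_g q0 q1)"
    using integral_h_tilde_g_sums(2)[of UNIV] by simp
  have "0 < (\<Sum>n. weight n * measure lborel {0..<orbit n})"
    by (rule suminf_pos2[of _ 0]) (use s r_Q_pos weight_pos in \<open>auto simp: sums_iff less_imp_le\<close>)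
  then show ?thesis using s by (simp add: sums_iff)
qed

lemma greedy_proportional:
  assumes "stationary G F" "\<And>x. x \<notin> {0..N} \<Longrightarrow> F x = 0" "integral\<^sup>L lborel F = 1"
  obtains k where "k > 0" "AE x in lborel. h_tilde_g q0 q1 x = k * F x"
  using stationary_unique[OF assms stationary_h_tilde_g h_tilde_g_outside] integral_h_tilde_g_pos
  by blast

end

section \<open>The lazy map as a reflected greedy map\<close>

text \<open>
  The conjugacy need hold only where \<open>F\<close> does not vanish.  This matters because
  the maps are extended beyond their intervals by formulas that do not correspond under conjugation.
\<close>

lemma stationary_affine_conjugate:
  fixes p t :: real
  assumes st: "stationary L F" and p: "p \<noteq> 0"
    and conj: "\<And>z. F (t + p * z) \<noteq> 0 \<Longrightarrow> L (t + p * z) = t + p * T z"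
  shows "stationary T (\<lambda>z. F (t + p * z))"
  unfolding stationary_def
proof (intro conjI ballI)
  have iF: "integrable lborel F" using st by (simp add: stationary_def)
  then show "integrable lborel (\<lambda>z. F (t + p * z))"
    using p by (simp add: lborel_integrable_real_affine_iff)
  fix A :: "real set" assume A[measurable]: "A \<in> sets borel"
  define B where "B = (\<lambda>x. (x - t) / p) -` A"
  have B: "B \<in> sets borel"
    unfolding B_def using measurable_sets[of "\<lambda>x::real. (x - t) / p" borel borel A] by simp
  have affine: "(\<integral>x. H x \<partial>lborel) = \<bar>p\<bar> * (\<integral>z. H (t + p * z) \<partial>lborel)" for H :: "real \<Rightarrow> real"
    using lborel_integral_real_affine[OF p, of H t] by simp
  have "(\<lambda>z. indicator (T -` A) z * F (t + p * z)) =
      (\<lambda>z. indicator (L -` B) (t + p * z) * F (t + p * z))"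
  proof
    show "indicator (T -` A) z * F (t + p * z) = indicator (L -` B) (t + p * z) * F (t + p * z)" for z
      using conj[of z] p by (cases "F (t + p * z) = 0") (auto simp: B_def indicator_def)
  qed
  then have "\<bar>p\<bar> * (\<integral>z. indicator (T -` A) z * F (t + p * z) \<partial>lborel)
      = (\<integral>x. indicator (L -` B) x * F x \<partial>lborel)"
    by (simp only: affine[of "\<lambda>x. indicator (L -` B) x * F x"])
  also have "\<dots> = (\<integral>x. indicator B x * F x \<partial>lborel)"
    using st B by (simp add: stationary_def)
  also have "\<dots> = \<bar>p\<bar> * (\<integral>z. indicator B (t + p * z) * F (t + p * z) \<partial>lborel)"
    by (rule affine)
  also have "(\<lambda>z. indicator B (t + p * z) * F (t + p * z)) = (\<lambda>z. indicator A z * F (t + p * z))"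
    using p by (auto simp: B_def indicator_def)
  finally show "(\<integral>z. indicator (T -` A) z * F (t + p * z) \<partial>lborel) =
      (\<integral>z. indicator A z * F (t + p * z) \<partial>lborel)"
    using p by simp
qed

context two_bases
begin

text \<open>
  The decreasing affine map of the interval \<open>[0, 1 / (q0 - 1)]\<close> of the pair \<open>(q1, q0)\<close> onto
  \<open>[0, N]\<close>.  It is written as \<open>t + p * z\<close> to match the affine substitution rules for integrals.
\<close>

definition reflect :: "real \<Rightarrow> real" where
  "reflect z = N + - ((q0 - 1) / (q1 - 1)) * z"

lemma slope_pos: "(q0 - 1) / (q1 - 1) > 0"
  using q0 q1 by simp

lemma reflect_nonneg_iff: "reflect z \<ge> 0 \<longleftrightarrow> z \<le> 1 / (q0 - 1)"
  using q0 q1 by (simp add: reflect_def field_simps)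

lemma reflect_le_N_iff: "reflect z \<le> N \<longleftrightarrow> 0 \<le> z"
proof -
  have "reflect z \<le> N \<longleftrightarrow> 0 \<le> (q0 - 1) / (q1 - 1) * z" by (simp add: reflect_def)
  also have "\<dots> \<longleftrightarrow> 0 \<le> z" using slope_pos zero_le_mult_iff by (metis less_le_not_le order_less_imp_le)
  finally show ?thesis .
qed

lemma reflect_in_I_iff: "reflect z \<in> {0..N} \<longleftrightarrow> z \<in> {0..1 / (q0 - 1)}"
  using reflect_nonneg_iff[of z] reflect_le_N_iff[of z] by auto

lemma reflect_in_J0_iff: "reflect z \<in> {0..1 / (q0 * (q1 - 1))} \<longleftrightarrow> 1 / q0 \<le> z \<and> z \<le> 1 / (q0 - 1)"
proof -
  have "reflect z - 1 / (q0 * (q1 - 1)) = (q0 - 1) / (q1 - 1) * (1 / q0 - z)"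
    using q0 q1 by (simp add: reflect_def divide_simps) (simp add: algebra_simps)
  then have "reflect z \<le> 1 / (q0 * (q1 - 1)) \<longleftrightarrow> (q0 - 1) / (q1 - 1) * (1 / q0 - z) \<le> 0"
    by linarith
  also have "\<dots> \<longleftrightarrow> 1 / q0 - z \<le> 0"
    by (metis slope_pos mult_le_0_iff less_le_not_le order_less_imp_le)
  finally show ?thesis using reflect_nonneg_iff[of z] by auto
qed

lemma lazy_reflect:
  assumes z: "z \<in> {0..1 / (q0 - 1)}"
  shows "lazy_map q0 q1 (reflect z) = reflect (greedy_map q1 q0 z)"
proof -
  have "lazy_map q0 q1 (reflect z) = (if 1 / q0 \<le> z then q0 * reflect z else q1 * reflect z - 1)"
    using z reflect_in_J0_iff[of z] by (auto simp: lazy_map_def lazy_J0_def)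
  also have "\<dots> = reflect (if 1 / q0 \<le> z then q0 * z - 1 else q1 * z)"
    using q0 q1 by (simp add: reflect_def divide_simps) (simp add: algebra_simps)
  also have "(if 1 / q0 \<le> z then q0 * z - 1 else q1 * z) = greedy_map q1 q0 z"
    using z by (simp add: greedy_map_def greedy_I0_def)
  finally show ?thesis .
qed

lemma l_Q_reflect: "l_Q q0 q1 = reflect (r_Q q1 q0)"
  using q0 q1 by (simp add: l_Q_def r_Q_def reflect_def divide_simps) (simp add: algebra_simps)

end

sublocale two_bases \<subseteq> swap: two_bases q1 q0
  using q0 q1 q01 by unfold_locales (auto simp: algebra_simps)

context two_bases
begin

lemma lazy_orbit: "(lazy_map q0 q1 ^^ n) (l_Q q0 q1) = reflect (swap.orbit n)"
proof (induction n)
  case 0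
  then show ?case by (simp add: l_Q_reflect)
next
  case (Suc n)
  then show ?case using lazy_reflect[OF swap.orbit_in_I[of n]] by simp
qed

lemma lazy_digit_reflect:
  "lazy_digit q0 q1 (l_Q q0 q1) n = 1 - greedy_digit q1 q0 (r_Q q1 q0) n"
  using swap.orbit_in_I[of "n - 1"] reflect_in_J0_iff[of "swap.orbit (n - 1)"]
    reflect_in_I_iff[of "swap.orbit (n - 1)"]
  by (auto simp: lazy_digit_def greedy_digit_def lazy_J1_def greedy_I1_def lazy_orbit)

lemma t_Q_eq: "t_Q q0 q1 n = n - s_Q q1 q0 n"
proof -
  have "t_Q q0 q1 n + s_Q q1 q0 n = (\<Sum>i = 1..n. 1)"
    unfolding t_Q_def s_Q_def sum.distrib[symmetric] lazy_digit_reflect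
    by (intro sum.cong) (auto simp: greedy_digit_def)
  then show ?thesis by simp
qed

lemma h_tilde_l_reflect:
  assumes z: "z \<in> {0..1 / (q0 - 1)}"
  shows "h_tilde_l q0 q1 (reflect z) = h_tilde_g q1 q0 z"
proof -
  have "reflect z \<in> {reflect y <.. N} \<longleftrightarrow> z \<in> {0..<y}" for y
    using z reflect_in_I_iff[of z] q0 q1
    by (auto simp: reflect_def divide_less_cancel mult_less_cancel_left)
  then have ind: "indicator {reflect y <.. N} (reflect z) = (indicator {0..<y} z :: real)" for y
    by (simp add: indicator_def)
  show ?thesis
    unfolding h_tilde_l_def h_tilde_g_def lazy_orbit ind t_Q_eq
    using swap.s_Q_le by (simp add: mult.commute)
qed

text \<open>
  The factor \<open>p\<close> normalises the transported density.  The conclusion is restricted to the interval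
  because \<open>h_tilde_l_reflect\<close> compares the two series on it.
\<close>

lemma lazy_proportional:
  assumes F: "stationary (lazy_map q0 q1) F" "\<And>x. x \<notin> {0..N} \<Longrightarrow> F x = 0" "integral\<^sup>L lborel F = 1"
  obtains k where "k > 0" "AE x in lborel. x \<in> {0..N} \<longrightarrow> h_tilde_l q0 q1 x = k * F x"
proof -
  define p where "p = (q0 - 1) / (q1 - 1)"
  have p: "p > 0" using q0 q1 by (simp add: p_def)
  have r: "reflect z = N + - p * z" for z by (simp add: reflect_def p_def)
  have st: "stationary (greedy_map q1 q0) (\<lambda>z. F (N + - p * z))"
  proof (rule stationary_affine_conjugate[OF F(1)])
    fix z assume "F (N + - p * z) \<noteq> 0"
    then have "z \<in> {0..1 / (q0 - 1)}"
      using F(2)[of "reflect z"] reflect_in_I_iff[of z] by (auto simp: r)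
    then show "lazy_map q0 q1 (N + - p * z) = N + - p * greedy_map q1 q0 z"
      using lazy_reflect[of z] by (simp add: r)
  qed (use p in simp)
  have int: "(\<integral>z. F (N + - p * z) \<partial>lborel) = 1 / p"
    using lborel_integral_real_affine[of "- p" F N] p F(3) by (simp add: field_simps)
  have "stationary (greedy_map q1 q0) (\<lambda>z. p * F (N + - p * z))"
    using st by (simp add: stationary_def mult.left_commute[of _ p])
  moreover have "p * F (N + - p * z) = 0" if "z \<notin> {0..1 / (q0 - 1)}" for z
    using F(2)[of "reflect z"] reflect_in_I_iff[of z] that by (auto simp: r)
  moreover have "(\<integral>z. p * F (N + - p * z) \<partial>lborel) = 1"
    using int p by simp
  ultimately obtain k where k: "k > 0"
      and AE: "AE z in lborel. h_tilde_g q1 q0 z = k * (p * F (N + - p * z))"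
    by (rule swap.greedy_proportional)
  have [measurable]: "F \<in> borel_measurable borel" "h_tilde_g q1 q0 \<in> borel_measurable borel"
    using F(1) swap.stationary_h_tilde_g by (auto simp: stationary_def)
  have "AE x in lborel. h_tilde_g q1 q0 (N / p + (- 1 / p) * x) = k * (p * F (N + - p * (N / p + (- 1 / p) * x)))"
    using p by (intro AE_borel_affine AE) auto
  then have "AE x in lborel. x \<in> {0..N} \<longrightarrow> h_tilde_l q0 q1 x = k * p * F x"
  proof eventually_elim
    case (elim x)
    define z where "z = N / p + (- 1 / p) * x"
    have "p * (M / p + (- 1 / p) * x) = M - x" for M using p by (simp add: field_simps)
    from this[of N] have "p * z = N - x" by (simp only: z_def)
    then have x: "x = reflect z" "N + - p * z = x" by (auto simp: r)
    have "h_tilde_g q1 q0 z = k * (p * F x)"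
      using elim unfolding z_def[symmetric] by (simp only: x(2))
    then show ?case
      using reflect_in_I_iff[of z] h_tilde_l_reflect[of z] x(1) by auto
  qed
  then show ?thesis using k p by (intro that[of "k * p"]) auto
qed

end

section \<open>Densities of invariant measures\<close>

text \<open>
  Extending the density by zero moves the invariance from the measure on the interval to Lebesgue integrals
  over the real line; preimages outside the interval do not matter as \<open>F\<close> vanishes there.
\<close>

lemma acip_density_stationary:
  assumes ac: "acip {0..b} T \<mu>" and den: "is_density_on {0..b} \<mu> h"
  defines "F \<equiv> (\<lambda>x. indicator {0..b} x * h x)"
  shows "stationary T F" "integral\<^sup>L lborel F = 1"
proof -
  let ?R = "restrict_space lborel {0..b}"
  have h[measurable]: "h \<in> borel_measurable ?R" and pos: "AE x in ?R. 0 \<le> h x"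
    and mu: "\<mu> = density ?R (\<lambda>x. ennreal (h x))"
    using den by (auto simp: is_density_on_def)
  have T[measurable]: "T \<in> measurable \<mu> \<mu>" and inv: "distr \<mu> \<mu> T = \<mu>"
    using ac by (auto simp: acip_def)
  interpret prob_space \<mu> using ac by (simp add: acip_def)
  have space: "space \<mu> = {0..b}" by (simp add: mu space_restrict_space)
  have int: "integral\<^sup>L \<mu> f = (\<integral>x. f x * F x \<partial>lborel)" if f: "f \<in> borel_measurable ?R" for f :: "real \<Rightarrow> real"
    unfolding mu F_def using pos
    by (subst integral_density[OF f h]) (auto simp: integral_restrict_space mult_ac)
  have "integrable \<mu> (\<lambda>x. 1::real)" by simp
  then have iF: "integrable lborel F"
    unfolding mu F_def using pos
    by (subst (asm) integrable_density) (auto simp: integrable_restrict_space)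
  show "integral\<^sup>L lborel F = 1"
    using int[of "\<lambda>_. 1"] prob_space by simp
  have "(\<integral>x. indicator (T -` A) x * F x \<partial>lborel) = (\<integral>x. indicator A x * F x \<partial>lborel)"
    if A: "A \<in> sets borel" for A
  proof -
    have A': "A \<inter> {0..b} \<in> sets \<mu>"
      using A by (auto simp: mu sets_restrict_space)
    have Tspace: "T x \<in> {0..b}" if "x \<in> {0..b}" for x
      using measurable_space[OF T, of x] that by (simp add: space)
    have pre: "T -` (A \<inter> {0..b}) \<inter> {0..b} \<in> sets \<mu>"
      using measurable_sets[OF T A'] by (simp add: space)
    have F0: "F x = 0" if "x \<notin> {0..b}" for x using that by (simp add: F_def)
    have meas: "measure \<mu> S = (\<integral>x. indicator S x * F x \<partial>lborel)" if "S \<in> sets \<mu>" for S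
    proof -
      have "S \<in> sets ?R" using that by (simp add: mu)
      then show ?thesis using int[of "indicator S"] sets.sets_into_space[OF that] 
        by (simp add: Int_absorb2)
    qed
    have "measure \<mu> (A \<inter> {0..b}) = measure (distr \<mu> \<mu> T) (A \<inter> {0..b})" by (simp add: inv)
    also have "\<dots> = measure \<mu> (T -` (A \<inter> {0..b}) \<inter> {0..b})"
      by (simp add: measure_distr[OF T A'] space)
    finally have "(\<integral>x. indicator (A \<inter> {0..b}) x * F x \<partial>lborel) =
        (\<integral>x. indicator (T -` (A \<inter> {0..b}) \<inter> {0..b}) x * F x \<partial>lborel)"
      by (simp only: meas[OF A'] meas[OF pre])
    moreover have "indicator (A \<inter> {0..b}) x * F x = indicator A x * F x" for x
      using F0[of x] by (auto simp: indicator_def)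
    moreover have "indicator (T -` (A \<inter> {0..b}) \<inter> {0..b}) x * F x = indicator (T -` A) x * F x" for x
      using F0[of x] Tspace[of x] by (auto simp: indicator_def)
    ultimately show ?thesis by (simp only:)
  qed
  then show "stationary T F" using iF by (simp add: stationary_def)
qed

lemma proportional_aeI:
  assumes k: "k > 0" and AE: "AE x in lborel. x \<in> {0..b} \<longrightarrow> g x = k * (indicator {0..b} x * h x)"
  shows "proportional_ae {0..b} h g"
proof -
  have "AE x in restrict_space lborel {0..b}. g x = k * h x"
    using AE by (subst AE_restrict_space_iff) auto
  moreover from this have "AE x in restrict_space lborel {0..b}. h x = (1 / k) * g x"
    by eventually_elim (use k in simp)
  ultimately show ?thesis unfolding proportional_ae_def by blast
qed

theorem theorem1p3:
  fixes q0 q1 :: real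
    and \<mu>\<^sub>g \<mu>\<^sub>l :: "real measure"
    and h\<^sub>g h\<^sub>l :: "real \<Rightarrow> real"
  assumes "q0 > 1" and "q1 > 1" and "q0 + q1 \<ge> q0 * q1"
    and "acip (I_Q q0 q1) (greedy_map q0 q1) \<mu>\<^sub>g"
    and "is_density_on (I_Q q0 q1) \<mu>\<^sub>g h\<^sub>g"
    and "acip (I_Q q0 q1) (lazy_map q0 q1) \<mu>\<^sub>l"
    and "is_density_on (I_Q q0 q1) \<mu>\<^sub>l h\<^sub>l"
  shows "proportional_ae (I_Q q0 q1) h\<^sub>g (h_tilde_g q0 q1) \<and>
         proportional_ae (I_Q q0 q1) h\<^sub>l (h_tilde_l q0 q1)"
proof -
  interpret two_bases q0 q1 using assms(1-3) by unfold_locales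
  note greedy = acip_density_stationary[OF assms(4,5)[unfolded I_Q_def]]
  note lazy = acip_density_stationary[OF assms(6,7)[unfolded I_Q_def]]
  obtain k where "k > 0" "AE x in lborel. h_tilde_g q0 q1 x = k * (indicator {0..N} x * h\<^sub>g x)"
    by (rule greedy_proportional[OF greedy(1) _ greedy(2)]) auto
  then have "proportional_ae {0..N} h\<^sub>g (h_tilde_g q0 q1)"
    by (intro proportional_aeI[of k]) auto
  moreover obtain k where "k > 0"
      "AE x in lborel. x \<in> {0..N} \<longrightarrow> h_tilde_l q0 q1 x = k * (indicator {0..N} x * h\<^sub>l x)"
    by (rule lazy_proportional[OF lazy(1) _ lazy(2)]) auto
  then have "proportional_ae {0..N} h\<^sub>l (h_tilde_l q0 q1)"
    by (intro proportional_aeI[of k]) auto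
  ultimately show ?thesis by (simp add: I_Q_def)
qed

end
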